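(* For $0<d<1$, $\ell\in\mathbb Z$ and integers $k\ge 0$ define $$\mathfrak e_{\ell,k,d}^2:=\int\lambda^{\ell-2}\det(\mathbb T_{k,d}-\lambda I)^2\,\mu_{\mathrm{MP},d}(\mathrm d\lambda),$$ where for $k=0$ this means $\mathfrak e_{\ell,0,d}^2:=\int\lambda^{\ell-2}\mu_{\mathrm{MP},d}(\mathrm d\lambda)$. For $d=1$ the same definition is used (and is valid) for $\ell\ge2$. Then: (i) for $0<d<1$ and every $\ell\in\mathbb Z$, $\mathfrak e_{\ell,k,d}^2\to0$ as $k\to\infty$; (ii) for $0<d<1$ and all $k\ge 0$, $\mathfrak e_{1,k,d}^2=\dfrac{d^k}{1-d}$; (iii) for $0<d\le1$ and all $k\ge0$, $\mathfrak e_{2,k,d}^2=d^k$, and $\mathfrak e_{3,k,d}^2=d^k(1+d)$ if $k\ge1$, while $\mathfrak e_{3,0,d}^2=1$.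
   Context: Marchenko--Pastur law $\mu_{\mathrm{MP},d}$, $0<d\le1$: probability measure on $\mathbb R$ with density $\rho_{\mathrm{MP},d}(x)=\frac1{2\pi d}\frac{\sqrt{|(d_+-x)(x-d_-)|}}{x}\mathbf 1_{[d_-,d_+]}(x)$, $d_\pm=(1\pm\sqrt d)^2$. $\mathbb T_{k,d}$ is the upper-left $k\times k$ block of the infinite matrix $\mathbb T_d=\mathbb H_d\mathbb H_d^*$, where $\mathbb H_d$ is the infinite lower bidiagonal matrix with all diagonal entries $1$ and all first-subdiagonal entries $\sqrt d$. *)

theory Defs
  imports "HOL-Analysis.Analysis" "Jordan_Normal_Form.Determinant"
begin

definition mp_minus :: "real \<Rightarrow> real" where
  "mp_minus d = (1 - sqrt d)\<^sup>2"

definition mp_plus :: "real \<Rightarrow> real" where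
  "mp_plus d = (1 + sqrt d)\<^sup>2"

definition mp_density :: "real \<Rightarrow> real \<Rightarrow> real" where
  "mp_density d x =
     1 / (2 * pi * d) * (sqrt \<bar>(mp_plus d - x) * (x - mp_minus d)\<bar> / x)
       * indicator {mp_minus d..mp_plus d} x"

definition mp_law :: "real \<Rightarrow> real measure" where
  "mp_law d = density lborel (\<lambda>x. ennreal (mp_density d x))"

text \<open>Infinite matrices are functions of two indices, both starting at 0.  All entries
  here are real, so the adjoint is the transpose.\<close>

definition H_inf :: "real \<Rightarrow> nat \<Rightarrow> nat \<Rightarrow> real" where
  "H_inf d i j = (if i = j then 1 else if i = Suc j then sqrt d else 0)"

definition T_inf :: "real \<Rightarrow> nat \<Rightarrow> nat \<Rightarrow> real" where
  "T_inf d i j = (\<Sum>m. H_inf d i m * H_inf d j m)"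

text \<open>The series defining an entry of the product has only finitely many nonzero terms.\<close>

lemma T_inf_eq_sum: "T_inf d i j = (\<Sum>m\<le>i. H_inf d i m * H_inf d j m)"
  unfolding T_inf_def by (rule suminf_finite) (auto simp: H_inf_def)

definition T_block :: "nat \<Rightarrow> real \<Rightarrow> real mat" where
  "T_block k d = Matrix.mat k k (\<lambda>(i, j). T_inf d i j)"

definition err_integrand :: "int \<Rightarrow> nat \<Rightarrow> real \<Rightarrow> real \<Rightarrow> real" where
  "err_integrand l k d x =
     x powi (l - 2) * (Determinant.det (T_block k d - x \<cdot>\<^sub>m 1\<^sub>m k))\<^sup>2"

text \<open>The squared quantity itself, not its square root.\<close>

definition err_sq :: "int \<Rightarrow> nat \<Rightarrow> real \<Rightarrow> real" where
  "err_sq l k d = (\<integral>x. err_integrand l k d x \<partial>mp_law d)"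

text \<open>The determinant of the empty matrix is 1, which gives the stated convention for
  \<open>k = 0\<close>.\<close>

lemma err_sq_0: "err_sq l 0 d = (\<integral>x. x powi (l - 2) \<partial>mp_law d)"
proof -
  have "Determinant.det (T_block 0 d - x \<cdot>\<^sub>m 1\<^sub>m 0) = 1" for x
    by (rule det_dim_zero) (simp add: minus_carrier_mat)
  then show ?thesis
    by (simp add: err_sq_def err_integrand_def)
qed

end

theory Submission
  imports Defs
begin

text \<open>Put \<open>r = sqrt d\<close>. The support \<open>[(1 - r)\<^sup>2, (1 + r)\<^sup>2]\<close> is parametrised by
  \<open>\<lambda>(t) = 1 + d - 2 r cos t\<close>, \<open>0 < t < \<pi>\<close>, and two things become simple in the angle \<open>t\<close>.
  The Marchenko--Pastur law turns into \<open>(2 / \<pi>) sin\<^sup>2 t / \<lambda>(t) dt\<close>. The determinants of the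
  shifted tridiagonal blocks satisfy a three-term recurrence that is, up to the factor \<open>r\<close>,
  the recurrence of Chebyshev polynomials of the second kind in \<open>cos t\<close>; so the determinant of
  order \<open>k\<close> times \<open>sin t\<close> equals \<open>r ^ k w\<^sub>k(t)\<close> with the wave
  \<open>w\<^sub>k(t) = sin ((k + 1) t) - r sin (k t)\<close>. Hence the squared error is
  \<open>d ^ k (2 / \<pi>)\<close> times the integral of \<open>\<lambda>(t) ^ (\<ell> - 3) w\<^sub>k(t)\<^sup>2\<close> over \<open>[0, \<pi>]\<close>.
  For \<open>d < 1\<close> the function \<open>\<lambda>\<close> stays away from \<open>0\<close>, the integral is bounded in \<open>k\<close>, and the
  factor \<open>d ^ k\<close> gives the limit. For \<open>\<ell> = 3\<close> the value is immediate from the orthogonality of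
  the sines.

  For \<open>\<ell> = 1, 2\<close> the negative powers of \<open>\<lambda>\<close> are removed by the identity
  \<open>w\<^sub>k = \<lambda> sin ((k + 1) t) + r w\<^sub>k\<^sub>+\<^sub>1\<close>, which says that \<open>q\<^sub>k = w\<^sub>k / \<lambda>\<close> satisfies
  \<open>q\<^sub>k = sin ((k + 1) t) + r q\<^sub>k\<^sub>+\<^sub>1\<close>; morally \<open>q\<^sub>k\<close> is the sine series
  \<open>\<Sum>j. r ^ j sin ((k + 1 + j) t)\<close>. Instead of summing the series, the recursion is applied under
  the integral: each quantity of interest is a bounded sequence with \<open>x\<^sub>k = c x\<^sub>k\<^sub>+\<^sub>1\<close> and
  \<open>\<bar>c\<bar> < 1\<close>, hence zero (\<open>bounded_backward_contraction_zero\<close>). In this way \<open>q\<^sub>n\<close> is orthogonal to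
  the sines of frequency at most \<open>n\<close>, the integral of \<open>q\<^sub>k\<^sup>2\<close> is \<open>\<pi> / (2 (1 - d))\<close> (Parseval), and
  that of \<open>w\<^sub>k q\<^sub>k\<close> is \<open>\<pi> / 2\<close>.

  At \<open>d = 1\<close> the contraction is lost and \<open>\<lambda>\<close> vanishes at \<open>t = 0\<close>. There half-angle formulas
  show that \<open>w\<^sub>k\<^sup>2\<close> is divisible by \<open>\<lambda>\<close>, with quotient \<open>(1 + cos ((2 k + 1) t)) / 2\<close>, which settles
  the case \<open>\<ell> = 2\<close> (\<open>wave_sq_critical\<close>).\<close>

section \<open>The characteristic polynomials of the blocks\<close>

lemma T_inf_tridiagonal:
  assumes "0 < d"
  shows "T_inf d i j =
    (if i = j then (if i = 0 then 1 else 1 + d)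
     else if i = Suc j \<or> j = Suc i then sqrt d else 0)"
proof (cases i)
  case 0
  then show ?thesis by (auto simp: T_inf_eq_sum H_inf_def)
next
  case (Suc n)
  have "(\<Sum>m\<le>i. H_inf d i m * H_inf d j m)
      = (\<Sum>m\<in>{n, Suc n}. H_inf d i m * H_inf d j m)"
    by (rule sum.mono_neutral_right) (auto simp: H_inf_def Suc)
  also have "\<dots> = sqrt d * H_inf d j n + H_inf d j (Suc n)"
    by (simp add: H_inf_def Suc)
  finally show ?thesis
    using assms by (auto simp: T_inf_eq_sum H_inf_def Suc)
qed

definition block_charpoly :: "real \<Rightarrow> nat \<Rightarrow> real \<Rightarrow> real" where
  "block_charpoly d k x = Determinant.det (T_block k d - x \<cdot>\<^sub>m 1\<^sub>m k)"

lemma block_charpoly_0: "block_charpoly d 0 x = 1"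
  unfolding block_charpoly_def by (rule det_dim_zero) (simp add: minus_carrier_mat)

lemma shifted_block_eq_mat:
  "T_block k d - x \<cdot>\<^sub>m 1\<^sub>m k = Matrix.mat k k (\<lambda>(i, j). T_inf d i j - (if i = j then x else 0))"
  by (rule eq_matI) (auto simp: T_block_def)

lemma block_charpoly_1:
  assumes "0 < d"
  shows "block_charpoly d (Suc 0) x = 1 - x"
  unfolding block_charpoly_def shifted_block_eq_mat
  by (subst det_single) (auto simp: T_inf_tridiagonal[OF assms])

text \<open>The three-term recurrence of a tridiagonal determinant, by expanding along the last row and then
  the one remaining off-diagonal minor along its last column. The diagonal entry is \<open>1 + d\<close> from
  the second row on; only the first row has \<open>1\<close>, and it enters through the
  determinant of order \<open>1\<close>.\<close>
lemma block_charpoly_Suc_Suc: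
  assumes "0 < d"
  shows "block_charpoly d (Suc (Suc k)) x
    = (1 + d - x) * block_charpoly d (Suc k) x - d * block_charpoly d k x"
proof -
  define e where "e = (\<lambda>i j. T_inf d i j - (if i = j then x else 0))"
  define M where "M n = Matrix.mat n n (\<lambda>(i, j). e i j)" for n
  have chi: "block_charpoly d n x = Determinant.det (M n)" for n
    by (simp add: block_charpoly_def shifted_block_eq_mat M_def e_def)
  define B where "B = mat_delete (M (Suc (Suc k))) (Suc k) k"
  have B_carrier: "B \<in> carrier_mat (Suc k) (Suc k)"
    by (rule carrier_matI) (simp_all add: B_def M_def)
  have B_last: "B $$ (i, k) = (if i = k then sqrt d else 0)" if "i < Suc k" for i
    using that by (auto simp: B_def M_def mat_delete_def e_def T_inf_tridiagonal[OF assms])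
  have minor_last: "mat_delete (M (Suc n)) n n = M n" for n
    by (rule eq_matI) (auto simp: mat_delete_def M_def)
  have minor_B: "mat_delete B k k = M k"
    by (rule eq_matI) (auto simp: mat_delete_def M_def B_def)
  have "Determinant.det B = (\<Sum>i<Suc k. B $$ (i, k) * cofactor B i k)"
    by (rule laplace_expansion_column[OF B_carrier]) simp
  also have "\<dots> = sqrt d * cofactor B k k"
    by (simp add: B_last)
  also have "\<dots> = sqrt d * Determinant.det (M k)"
    by (simp add: cofactor_def minor_B)
  finally have det_B: "Determinant.det B = sqrt d * Determinant.det (M k)" .
  have M_carrier: "M (Suc (Suc k)) \<in> carrier_mat (Suc (Suc k)) (Suc (Suc k))"
    by (simp add: M_def)
  have M_last: "M (Suc (Suc k)) $$ (Suc k, j)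
      = (if j = Suc k then 1 + d - x else if j = k then sqrt d else 0)" if "j < Suc (Suc k)" for j
    using that by (auto simp: M_def e_def T_inf_tridiagonal[OF assms])
  have "Determinant.det (M (Suc (Suc k)))
      = (\<Sum>j<Suc (Suc k). M (Suc (Suc k)) $$ (Suc k, j) * cofactor (M (Suc (Suc k))) (Suc k) j)"
    by (rule laplace_expansion_row[OF M_carrier]) simp
  also have "\<dots> = sqrt d * cofactor (M (Suc (Suc k))) (Suc k) k
      + (1 + d - x) * cofactor (M (Suc (Suc k))) (Suc k) (Suc k)"
    by (simp add: M_last)
  also have "\<dots> = - (sqrt d * Determinant.det B) + (1 + d - x) * Determinant.det (M (Suc k))"
    by (simp add: cofactor_def B_def[symmetric] minor_last)
  finally have "Determinant.det (M (Suc (Suc k))) = (1 + d - x) * Determinant.det (M (Suc k))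
      - (sqrt d * sqrt d) * Determinant.det (M k)"
    by (simp only: det_B algebra_simps)
  then show ?thesis
    using assms by (simp add: chi)
qed

lemma continuous_block_charpoly:
  assumes "0 < d"
  shows "continuous_on UNIV (block_charpoly d k)"
proof -
  have "continuous_on UNIV (block_charpoly d k) \<and> continuous_on UNIV (block_charpoly d (Suc k))"
  proof (induction k)
    case 0
    have "block_charpoly d 0 = (\<lambda>x. 1)" "block_charpoly d (Suc 0) = (\<lambda>x. 1 - x)"
      by (simp_all add: fun_eq_iff block_charpoly_0 block_charpoly_1[OF assms])
    then show ?case by (auto intro!: continuous_intros)
  next
    case (Suc k)
    have "block_charpoly d (Suc (Suc k))
        = (\<lambda>x. (1 + d - x) * block_charpoly d (Suc k) x - d * block_charpoly d k x)"
      by (simp add: fun_eq_iff block_charpoly_Suc_Suc[OF assms])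
    with Suc show ?case by (auto intro!: continuous_intros)
  qed
  then show ?thesis by blast
qed

section \<open>The angular parametrisation of the support\<close>

text \<open>The sign in front of the cosine makes the map increasing on \<open>[0, \<pi>]\<close>, from the lower to the
  upper edge of the support.\<close>
definition mp_angle :: "real \<Rightarrow> real \<Rightarrow> real" where
  "mp_angle d t = 1 + d - 2 * sqrt d * cos t"

definition wave :: "real \<Rightarrow> nat \<Rightarrow> real \<Rightarrow> real" where
  "wave d k t = sin (real (Suc k) * t) - sqrt d * sin (real k * t)"

lemma sin_Suc_Suc:
  "sin (real (Suc (Suc k)) * t) = 2 * cos t * sin (real (Suc k) * t) - sin (real k * t)"
proof -
  have "sin (real (Suc k) * t + t) + sin (real (Suc k) * t - t) = 2 * cos t * sin (real (Suc k) * t)"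
    by (simp add: sin_add sin_diff)
  then show ?thesis by (simp add: algebra_simps)
qed

lemma wave_Suc_Suc: "wave d (Suc (Suc k)) t = 2 * cos t * wave d (Suc k) t - wave d k t"
  unfolding wave_def sin_Suc_Suc[of "Suc k"] sin_Suc_Suc[of k] by (simp add: algebra_simps)

text \<open>At \<open>x = mp_angle d t\<close> the coefficient \<open>1 + d - x\<close> is \<open>2 * sqrt d * cos t\<close>, so after division
  by \<open>sqrt d ^ k\<close> the recurrence for the determinants is the addition formula for sines.\<close>
lemma block_charpoly_angle:
  assumes "0 < d"
  shows "block_charpoly d k (mp_angle d t) * sin t = sqrt d ^ k * wave d k t"
proof -
  have dd: "sqrt d * sqrt d = d" using assms by simp
  have "block_charpoly d k (mp_angle d t) * sin t = sqrt d ^ k * wave d k t \<and>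
    block_charpoly d (Suc k) (mp_angle d t) * sin t = sqrt d ^ Suc k * wave d (Suc k) t"
  proof (induction k)
    case 0
    have "wave d (Suc 0) t = (2 * cos t - sqrt d) * sin t"
      using sin_double[of t] by (simp add: wave_def algebra_simps)
    moreover have "(2 * sqrt d * cos t - sqrt d * sqrt d) * sin t
        = sqrt d * ((2 * cos t - sqrt d) * sin t)"
      by (simp only: algebra_simps)
    ultimately show ?case
      using dd by (simp add: block_charpoly_0 block_charpoly_1[OF assms] wave_def[of d 0] mp_angle_def)
  next
    case (Suc k)
    have "block_charpoly d (Suc (Suc k)) (mp_angle d t) * sin t
        = 2 * sqrt d * cos t * (block_charpoly d (Suc k) (mp_angle d t) * sin t)
          - d * (block_charpoly d k (mp_angle d t) * sin t)"
      by (simp add: block_charpoly_Suc_Suc[OF assms] mp_angle_def algebra_simps)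
    also have "\<dots> = 2 * sqrt d * cos t * (sqrt d ^ Suc k * wave d (Suc k) t)
        - (sqrt d * sqrt d) * (sqrt d ^ k * wave d k t)"
      using Suc dd by simp
    also have "\<dots> = sqrt d ^ Suc (Suc k) * wave d (Suc (Suc k)) t"
      by (simp add: wave_Suc_Suc algebra_simps del: real_sqrt_mult_self)
    finally show ?case using Suc by blast
  qed
  then show ?thesis by blast
qed

text \<open>The factorisation \<open>\<lambda> = (1 - r e\<^sup>i\<^sup>t) (1 - r e\<^sup>-\<^sup>i\<^sup>t)\<close> in real form: \<open>w\<^sub>k\<close> is the imaginary part of
  \<open>e\<^sup>i\<^sup>k\<^sup>t (e\<^sup>i\<^sup>t - r)\<close>, and forming \<open>w\<^sub>k - r w\<^sub>k\<^sub>+\<^sub>1\<close> multiplies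
  this complex number by \<open>1 - r e\<^sup>i\<^sup>t\<close>. This identity is what
  allows negative powers of \<open>\<lambda>\<close> to be integrated.\<close>
lemma wave_step:
  assumes "0 < d"
  shows "wave d k t = mp_angle d t * sin (real (Suc k) * t) + sqrt d * wave d (Suc k) t"
proof -
  have dd: "sqrt d * (sqrt d * c) = d * c" for c using assms by simp
  show ?thesis
    unfolding wave_def mp_angle_def sin_Suc_Suc[of k] by (simp add: algebra_simps dd)
qed

section \<open>The law in the angular variable\<close>

lemma mp_angle_pos:
  assumes "0 < d" "0 < t" "t < pi"
  shows "0 < mp_angle d t"
proof -
  have "cos t < 1" using assms cos_monotone_0_pi[of 0 t] by simp
  then have "0 < 2 * sqrt d * (1 - cos t)" using assms by simp
  moreover have "mp_angle d t = (1 - sqrt d)\<^sup>2 + 2 * sqrt d * (1 - cos t)"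
    using assms by (simp add: mp_angle_def power2_eq_square algebra_simps)
  ultimately show ?thesis by (metis add_nonneg_pos zero_le_power2)
qed

lemma mp_angle_ge:
  assumes "0 < d"
  shows "(1 - sqrt d)\<^sup>2 \<le> mp_angle d t"
proof -
  have "mp_angle d t = (1 - sqrt d)\<^sup>2 + 2 * sqrt d * (1 - cos t)"
    using assms by (simp add: mp_angle_def power2_eq_square algebra_simps)
  then show ?thesis using assms by simp
qed

lemma mp_angle_image:
  assumes "0 < d"
  shows "mp_angle d ` {0<..<pi} = {mp_minus d<..<mp_plus d}"
proof (intro equalityI subsetI)
  fix x assume "x \<in> mp_angle d ` {0<..<pi}"
  then obtain t where t: "0 < t" "t < pi" "x = mp_angle d t" by auto
  have "cos t < 1" "-1 < cos t"
    using t cos_monotone_0_pi[of 0 t] cos_monotone_0_pi[of t pi] by auto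
  then have "0 < sqrt d * (1 - cos t)" "0 < sqrt d * (1 + cos t)"
    using assms by (auto intro!: mult_pos_pos)
  then show "x \<in> {mp_minus d<..<mp_plus d}"
    using assms by (simp add: t(3) mp_angle_def mp_minus_def mp_plus_def power2_eq_square algebra_simps)
next
  fix x assume x: "x \<in> {mp_minus d<..<mp_plus d}"
  define y where "y = (1 + d - x) / (2 * sqrt d)"
  have "-1 < y" "y < 1"
    using x assms
    by (simp_all add: y_def mp_minus_def mp_plus_def power2_eq_square field_simps)
  then have "0 < arccos y" "arccos y < pi" "cos (arccos y) = y"
    using arccos_lt_bounded[of y] by auto
  moreover from this have "mp_angle d (arccos y) = x"
    using assms by (simp add: mp_angle_def y_def)
  ultimately show "x \<in> mp_angle d ` {0<..<pi}" by (metis greaterThanLessThan_iff image_eqI)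
qed

text \<open>The square root in the density becomes \<open>2 * sqrt d * sin t\<close>, equal to the Jacobian of the
  substitution; their product supplies the \<open>sin\<^sup>2\<close>.\<close>
lemma mp_density_angle:
  assumes "0 < d" "0 < t" "t < pi"
  shows "2 * sqrt d * sin t * mp_density d (mp_angle d t) = 2 / pi * (sin t)\<^sup>2 / mp_angle d t"
proof -
  have "mp_angle d t \<in> {mp_minus d<..<mp_plus d}"
    using assms mp_angle_image[of d] by auto
  then have ind: "indicator {mp_minus d..mp_plus d} (mp_angle d t) = (1::real)" by simp
  have s: "0 < sin t" using assms by (simp add: sin_gt_zero)
  have "(mp_plus d - mp_angle d t) * (mp_angle d t - mp_minus d)
      = (2 * sqrt d * (1 + cos t)) * (2 * sqrt d * (1 - cos t))"
    using assms by (simp add: mp_plus_def mp_minus_def mp_angle_def power2_eq_square algebra_simps)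
  also have "\<dots> = (2 * sqrt d)\<^sup>2 * (1 - (cos t)\<^sup>2)"
    by (simp add: power2_eq_square algebra_simps)
  also have "\<dots> = (2 * sqrt d * sin t)\<^sup>2"
    by (simp add: sin_squared_eq power_mult_distrib)
  finally have "sqrt \<bar>(mp_plus d - mp_angle d t) * (mp_angle d t - mp_minus d)\<bar> = 2 * sqrt d * sin t"
    using s assms by simp
  then have "2 * sqrt d * sin t * mp_density d (mp_angle d t)
      = 2 * sqrt d * sin t * (1 / (2 * pi * d) * (2 * sqrt d * sin t / mp_angle d t))"
    unfolding mp_density_def ind by simp
  also have "\<dots> = (sqrt d * sqrt d) / d * (2 / pi * (sin t)\<^sup>2 / mp_angle d t)"
    by (simp add: power2_eq_square field_simps del: real_sqrt_mult_self)
  finally show ?thesis using assms by simp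
qed

text \<open>Change of variables on the open interval, where the angular map is injective. The continuous
  function \<open>F\<close> has to agree with the transformed integrand only inside \<open>(0, \<pi>)\<close>: at \<open>d = 1\<close> the
  transformed integrand contains a division by zero at \<open>t = 0\<close>, whose singularity is removable in
  the cases of interest.\<close>
lemma mp_law_integral_angle:
  fixes h F :: "real \<Rightarrow> real"
  assumes d: "0 < d"
    and h[measurable]: "h \<in> borel_measurable borel"
    and F: "continuous_on {0..pi} F"
    and eq: "\<And>t. 0 < t \<Longrightarrow> t < pi \<Longrightarrow> 2 / pi * (sin t)\<^sup>2 / mp_angle d t * h (mp_angle d t) = F t"
  shows "integrable (mp_law d) h" and "(\<integral>x. h x \<partial>mp_law d) = integral {0..pi} F"
proof -
  define J where "J = {mp_minus d<..<mp_plus d}"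
  define f where "f = (\<lambda>x. mp_density d x * h x)"
  have dens_meas[measurable]: "mp_density d \<in> borel_measurable borel"
    unfolding mp_density_def by measurable
  have f_meas[measurable]: "f \<in> borel_measurable borel" unfolding f_def by measurable
  have dens_nonneg: "0 \<le> mp_density d x" for x
  proof (cases "x \<in> {mp_minus d..mp_plus d}")
    case True
    then have "0 \<le> x"
      using order_trans[OF zero_le_power2[of "1 - sqrt d"], of x] by (simp add: mp_minus_def)
    then show ?thesis using d by (simp add: mp_density_def)
  qed (simp add: mp_density_def)
  \<comment> \<open>The numerator of the density vanishes at both edges of the support, so that
    passing to the open interval loses nothing.\<close>
  have f_ind: "indicator J x * f x = f x" for x
    by (auto simp: J_def f_def mp_density_def indicator_def less_le)
  have substituted: "\<bar>2 * sqrt d * sin t\<bar> * f (mp_angle d t) = F t" if "t \<in> {0<..<pi}" for t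
  proof -
    have "0 < sin t" using that by (simp add: sin_gt_zero)
    then have "\<bar>2 * sqrt d * sin t\<bar> * f (mp_angle d t)
        = 2 * sqrt d * sin t * mp_density d (mp_angle d t) * h (mp_angle d t)"
      using d by (simp add: f_def)
    also have "\<dots> = 2 / pi * (sin t)\<^sup>2 / mp_angle d t * h (mp_angle d t)"
      using that by (simp only: mp_density_angle[OF d] greaterThanLessThan_iff)
    also have "\<dots> = F t" using that by (intro eq) auto
    finally show ?thesis .
  qed
  have F_int: "F absolutely_integrable_on {0<..<pi}"
    by (rule set_integrable_subset[OF absolutely_integrable_continuous_real[OF F]]) auto
  have "inj_on (mp_angle d) {0<..<pi}"
    using d by (auto simp: inj_on_def mp_angle_def intro: cos_inj_pi)
  moreover have "(mp_angle d has_field_derivative 2 * sqrt d * sin t) (at t within {0<..<pi})" for t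
    unfolding mp_angle_def by (auto intro!: derivative_eq_intros)
  moreover have "(\<lambda>t. \<bar>2 * sqrt d * sin t\<bar> * f (mp_angle d t)) absolutely_integrable_on {0<..<pi}"
    by (rule set_integrable_cong[OF refl refl substituted, THEN iffD2, OF _ F_int])
  moreover have "integral {0<..<pi} (\<lambda>t. \<bar>2 * sqrt d * sin t\<bar> * f (mp_angle d t)) = integral {0..pi} F"
    by (simp only: integral_open_interval_real integral_cong[of "{0<..<pi}", OF substituted])
  ultimately have "f absolutely_integrable_on mp_angle d ` {0<..<pi} \<and>
      integral (mp_angle d ` {0<..<pi}) f = integral {0..pi} F"
    by (subst has_absolute_integral_change_of_variables_1'[symmetric]) auto
  then have fJ: "f absolutely_integrable_on J" "integral J f = integral {0..pi} F"
    using mp_angle_image[OF d] by (simp_all add: J_def)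
  have "integrable lebesgue f"
    using fJ(1) by (simp add: set_integrable_def f_ind)
  then have f_int: "integrable lborel f"
    by (simp add: integrable_completion)
  have "integral\<^sup>L lborel f = integral\<^sup>L lebesgue f"
    by (simp add: integral_completion)
  also have "\<dots> = integral J f"
    using set_lebesgue_integral_eq_integral(2)[OF fJ(1)]
    by (simp add: set_lebesgue_integral_def f_ind)
  finally have f_val: "integral\<^sup>L lborel f = integral {0..pi} F"
    using fJ(2) by simp
  show "integrable (mp_law d) h"
    unfolding mp_law_def using f_int dens_nonneg
    by (subst integrable_real_density) (auto simp: f_def)
  show "(\<integral>x. h x \<partial>mp_law d) = integral {0..pi} F"
    unfolding mp_law_def using f_val dens_nonneg
    by (subst integral_real_density) (auto simp: f_def)
qed

lemma borel_measurable_err_integrand: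
  assumes "0 < d"
  shows "err_integrand l k d \<in> borel_measurable borel"
proof -
  have [measurable]: "block_charpoly d k \<in> borel_measurable borel"
    using continuous_block_charpoly[OF assms] by (rule borel_measurable_continuous_onI)
  have "(\<lambda>x. x powi (l - 2) * (block_charpoly d k x)\<^sup>2) \<in> borel_measurable borel"
    unfolding power_int_def by measurable
  then show ?thesis unfolding err_integrand_def block_charpoly_def .
qed

text \<open>The exponent drops from \<open>l - 2\<close> to \<open>l - 3\<close> because the law contributes a factor \<open>1 / \<lambda>\<close>.\<close>
lemma err_integrand_angle:
  assumes "0 < d" "0 < t" "t < pi"
  shows "2 / pi * (sin t)\<^sup>2 / mp_angle d t * err_integrand l k d (mp_angle d t)
    = 2 / pi * d ^ k * (mp_angle d t powi (l - 3) * (wave d k t)\<^sup>2)"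
proof -
  have pos: "0 < mp_angle d t" using assms by (rule mp_angle_pos)
  have p: "mp_angle d t powi (l - 2) = mp_angle d t * mp_angle d t powi (l - 3)"
    using pos power_int_add_1'[of "mp_angle d t" "l - 3"] by simp
  have "(sin t)\<^sup>2 * (block_charpoly d k (mp_angle d t))\<^sup>2 = (sqrt d ^ k * wave d k t)\<^sup>2"
    by (simp add: block_charpoly_angle[OF assms(1), symmetric] power_mult_distrib)
  also have "\<dots> = ((sqrt d)\<^sup>2) ^ k * (wave d k t)\<^sup>2"
    by (simp only: power_mult_distrib power_mult[symmetric] mult.commute)
  also have "\<dots> = d ^ k * (wave d k t)\<^sup>2"
    using assms by simp
  finally have s: "(sin t)\<^sup>2 * (block_charpoly d k (mp_angle d t))\<^sup>2 = d ^ k * (wave d k t)\<^sup>2" .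
  have "2 / pi * (sin t)\<^sup>2 / mp_angle d t * err_integrand l k d (mp_angle d t)
    = 2 / pi * mp_angle d t powi (l - 3) * ((sin t)\<^sup>2 * (block_charpoly d k (mp_angle d t))\<^sup>2)"
    using pos by (simp add: err_integrand_def block_charpoly_def[symmetric] p)
  then show ?thesis by (simp add: s)
qed

lemma err_sq_eq_wave_integral:
  assumes d: "0 < d" and G: "continuous_on {0..pi} G"
    and eq: "\<And>t. 0 < t \<Longrightarrow> t < pi \<Longrightarrow> mp_angle d t powi (l - 3) * (wave d k t)\<^sup>2 = G t"
  shows "integrable (mp_law d) (err_integrand l k d)"
    and "err_sq l k d = 2 / pi * d ^ k * integral {0..pi} G"
proof -
  have cont: "continuous_on {0..pi} (\<lambda>t. 2 / pi * d ^ k * G t)"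
    using G by (intro continuous_intros)
  have eq': "2 / pi * (sin t)\<^sup>2 / mp_angle d t * err_integrand l k d (mp_angle d t)
      = 2 / pi * d ^ k * G t" if "0 < t" "t < pi" for t
    using err_integrand_angle[OF d that] eq[OF that] by simp
  note sub = mp_law_integral_angle[OF d borel_measurable_err_integrand[OF d] cont eq']
  show "integrable (mp_law d) (err_integrand l k d)" by (rule sub(1))
  show "err_sq l k d = 2 / pi * d ^ k * integral {0..pi} G"
    using sub(2) by (simp add: err_sq_def)
qed

section \<open>Sine integrals\<close>

lemma integral_cos_multiple:
  "integral {0..pi} (\<lambda>t. cos (real_of_int n * t)) = (if n = 0 then pi else 0)"
proof (cases "n = 0")
  case False
  have "((\<lambda>t. cos (real_of_int n * t)) has_integral
      sin (real_of_int n * pi) / real_of_int n - sin (real_of_int n * 0) / real_of_int n) {0..pi}"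
    using False
    by (intro fundamental_theorem_of_calculus)
      (auto intro!: derivative_eq_intros simp flip: has_real_derivative_iff_has_vector_derivative)
  moreover have "sin (real_of_int n * pi) = 0"
    by (simp add: sin_zero_iff_int2)
  ultimately show ?thesis using False by (simp add: integral_unique)
qed simp

lemma integral_sin_sin:
  "integral {0..pi} (\<lambda>t. sin (real (Suc m) * t) * sin (real n * t)) = (if Suc m = n then pi / 2 else 0)"
proof -
  have e: "sin (real (Suc m) * t) * sin (real n * t)
      = 1 / 2 * cos (real_of_int (int (Suc m) - int n) * t)
        - 1 / 2 * cos (real_of_int (int (Suc m) + int n) * t)" for t
    using sin_times_sin[of "real (Suc m) * t" "real n * t"] by (simp add: algebra_simps)
  have "integral {0..pi} (\<lambda>t. sin (real (Suc m) * t) * sin (real n * t))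
      = integral {0..pi} (\<lambda>t. 1 / 2 * cos (real_of_int (int (Suc m) - int n) * t))
        - integral {0..pi} (\<lambda>t. 1 / 2 * cos (real_of_int (int (Suc m) + int n) * t))"
    unfolding e
    by (intro Henstock_Kurzweil_Integration.integral_diff integrable_continuous_interval continuous_intros)
  also have "\<dots> = 1 / 2 * integral {0..pi} (\<lambda>t. cos (real_of_int (int (Suc m) - int n) * t))
        - 1 / 2 * integral {0..pi} (\<lambda>t. cos (real_of_int (int (Suc m) + int n) * t))"
    by simp
  also have "\<dots> = (if Suc m = n then pi / 2 else 0)"
    unfolding integral_cos_multiple by simp
  finally show ?thesis .
qed

text \<open>Iterating gives \<open>x n = c ^ j * x (n + j)\<close> for all \<open>j\<close>, and boundedness of \<open>x\<close> lets \<open>j\<close> tend to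
  infinity. This replaces the summation of geometric sine series below.\<close>
lemma bounded_backward_contraction_zero:
  fixes x :: "nat \<Rightarrow> real"
  assumes "\<bar>c\<bar> < 1" and "\<And>n. \<bar>x n\<bar> \<le> B" and step: "\<And>n. n \<ge> start \<Longrightarrow> x n = c * x (Suc n)"
    and "start \<le> n"
  shows "x n = 0"
proof -
  have "x n = c ^ j * x (n + j)" for j
  proof (induction j)
    case (Suc j)
    then show ?case using step[of "n + j"] \<open>start \<le> n\<close> by simp
  qed simp
  then have "\<bar>x n\<bar> \<le> \<bar>c\<bar> ^ j * B" for j
    by (metis abs_ge_zero abs_mult assms(2) mult_left_mono power_abs zero_le_power)
  moreover have "(\<lambda>j. \<bar>c\<bar> ^ j * B) \<longlonglongrightarrow> 0 * B"
    using assms(1) by (intro tendsto_mult_right LIMSEQ_power_zero) simp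
  ultimately have "\<bar>x n\<bar> \<le> 0"
    using LIMSEQ_le_const[of "\<lambda>j. \<bar>c\<bar> ^ j * B" "0 * B" "\<bar>x n\<bar>"] by auto
  then show ?thesis by simp
qed

section \<open>Waves divided by the spectral parameter\<close>

text \<open>Despite the division, this is the sine series \<open>\<Sum>j. sqrt d ^ j * sin ((k + 1 + j) * t)\<close> when
  \<open>d < 1\<close>, as iterating \<open>resolvent_wave_step\<close> below indicates.\<close>
definition resolvent_wave :: "real \<Rightarrow> nat \<Rightarrow> real \<Rightarrow> real" where
  "resolvent_wave d k t = wave d k t / mp_angle d t"

lemma continuous_mp_angle [continuous_intros]: "continuous_on A (mp_angle d)"
  unfolding mp_angle_def by (intro continuous_intros)

lemma continuous_wave [continuous_intros]: "continuous_on A (wave d k)"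
  unfolding wave_def by (intro continuous_intros)

lemma abs_wave_le:
  assumes "0 < d"
  shows "\<bar>wave d k t\<bar> \<le> 1 + sqrt d"
proof -
  have "sqrt d * \<bar>sin (real k * t)\<bar> \<le> sqrt d * 1"
    using assms by (intro mult_left_mono) auto
  then have "\<bar>sqrt d * sin (real k * t)\<bar> \<le> sqrt d"
    using assms by (simp add: abs_mult)
  moreover have "\<bar>sin (real (Suc k) * t)\<bar> \<le> 1" by (rule abs_sin_le_one)
  ultimately show ?thesis unfolding wave_def by linarith
qed

lemma mp_angle_pos_less_one:
  assumes "0 < d" "d < 1"
  shows "0 < mp_angle d t"
proof -
  have "sqrt d < 1" using assms by simp
  then have "0 < (1 - sqrt d)\<^sup>2" by simp
  then show ?thesis using mp_angle_ge[OF assms(1), of t] by linarith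
qed

lemma resolvent_wave_step:
  assumes "0 < d" "d < 1"
  shows "resolvent_wave d k t = sin (real (Suc k) * t) + sqrt d * resolvent_wave d (Suc k) t"
  using mp_angle_pos_less_one[OF assms, of t] wave_step[OF assms(1), of k t]
  by (simp add: resolvent_wave_def field_simps)

lemma continuous_resolvent_wave:
  assumes "0 < d" "d < 1"
  shows "continuous_on A (resolvent_wave d k)"
  unfolding resolvent_wave_def using mp_angle_pos_less_one[OF assms]
  by (intro continuous_intros) (metis less_irrefl)

lemma resolvent_wave_bounded:
  assumes "0 < d" "d < 1"
  obtains B where "0 < B" "\<And>k t. \<bar>resolvent_wave d k t\<bar> \<le> B"
proof
  have "sqrt d < 1" using assms by simp
  then have p: "0 < (1 - sqrt d)\<^sup>2" by simp
  then show "0 < (1 + sqrt d) / (1 - sqrt d)\<^sup>2" using assms by (simp add: add_pos_pos)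
  show "\<bar>resolvent_wave d k t\<bar> \<le> (1 + sqrt d) / (1 - sqrt d)\<^sup>2" for k t
    using p abs_wave_le[OF assms(1), of k t] mp_angle_ge[OF assms(1), of t]
      mp_angle_pos_less_one[OF assms, of t]
    by (simp add: resolvent_wave_def abs_div_pos[symmetric]) (intro frac_le, auto)
qed

lemma abs_integral_le_bound:
  fixes f :: "real \<Rightarrow> real"
  assumes "continuous_on {0..pi} f" "\<And>t. \<bar>f t\<bar> \<le> B"
  shows "\<bar>integral {0..pi} f\<bar> \<le> B * pi"
  using integral_bound[of 0 pi f B] assms by simp

text \<open>The series of \<open>resolvent_wave d n\<close> starts at frequency \<open>n + 1\<close>. In the proof, passing from \<open>n\<close>
  to \<open>n + 1\<close> removes the frequency \<open>n + 1\<close>, which is orthogonal to \<open>sin (m * t)\<close>, and leaves a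
  factor \<open>sqrt d\<close>.\<close>
lemma integral_sin_resolvent_wave_eq_0:
  assumes d: "0 < d" "d < 1" and mn: "m \<le> n"
  shows "integral {0..pi} (\<lambda>t. sin (real m * t) * resolvent_wave d n t) = 0"
proof -
  define x where "x n = integral {0..pi} (\<lambda>t. sin (real m * t) * resolvent_wave d n t)" for n
  obtain B where B: "0 < B" "\<And>k t. \<bar>resolvent_wave d k t\<bar> \<le> B"
    using resolvent_wave_bounded[OF d] by blast
  note [continuous_intros] = continuous_resolvent_wave[OF d]
  have "\<bar>sin (real m * t) * resolvent_wave d n t\<bar> \<le> 1 * B" for n t
    unfolding abs_mult using B by (intro mult_mono) auto
  then have bound: "\<bar>x n\<bar> \<le> B * pi" for n
    unfolding x_def by (intro abs_integral_le_bound continuous_intros) simp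
  have step: "x n = sqrt d * x (Suc n)" if "n \<ge> m" for n
  proof -
    have "x n = integral {0..pi} (\<lambda>t. sin (real (Suc n) * t) * sin (real m * t)
        + sqrt d * (sin (real m * t) * resolvent_wave d (Suc n) t))"
      unfolding x_def resolvent_wave_step[OF d, of n] by (simp only: algebra_simps)
    also have "\<dots> = integral {0..pi} (\<lambda>t. sin (real (Suc n) * t) * sin (real m * t))
        + integral {0..pi} (\<lambda>t. sqrt d * (sin (real m * t) * resolvent_wave d (Suc n) t))"
      by (intro Henstock_Kurzweil_Integration.integral_add integrable_continuous_interval
          continuous_intros)
    finally show ?thesis using that unfolding integral_sin_sin by (simp add: x_def)
  qed
  have "x n = 0"
    using d by (intro bounded_backward_contraction_zero[where x = x and c = "sqrt d", OF _ bound step mn]) auto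
  then show ?thesis by (simp add: x_def)
qed

text \<open>Parseval's identity for the series, whose squared coefficients are \<open>1, d, d\<^sup>2, \<dots>\<close>. The mixed
  terms vanish by orthogonality, so the integrals satisfy \<open>I\<^sub>k = \<pi> / 2 + d I\<^sub>k\<^sub>+\<^sub>1\<close>; the deviation
  from the fixed point of this affine map is contracted.\<close>
lemma integral_resolvent_wave_sq:
  assumes d: "0 < d" "d < 1"
  shows "integral {0..pi} (\<lambda>t. (resolvent_wave d k t)\<^sup>2) = pi / 2 / (1 - d)"
proof -
  define x where "x k = integral {0..pi} (\<lambda>t. (resolvent_wave d k t)\<^sup>2) - pi / 2 / (1 - d)" for k
  obtain B where B: "0 < B" "\<And>k t. \<bar>resolvent_wave d k t\<bar> \<le> B"
    using resolvent_wave_bounded[OF d] by blast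
  note [continuous_intros] = continuous_resolvent_wave[OF d]
  have "\<bar>(resolvent_wave d k t)\<^sup>2\<bar> \<le> B\<^sup>2" for k t
    using power_mono[OF B(2)[of k t], of 2] by simp
  then have "\<bar>integral {0..pi} (\<lambda>t. (resolvent_wave d k t)\<^sup>2)\<bar> \<le> B\<^sup>2 * pi" for k
    by (intro abs_integral_le_bound continuous_intros)
  then have bound: "\<bar>x k\<bar> \<le> B\<^sup>2 * pi + \<bar>pi / 2 / (1 - d)\<bar>" for k
    unfolding x_def using abs_triangle_ineq4 order_trans by (meson add_right_mono)
  have step: "x k = d * x (Suc k)" for k
  proof -
    have "integral {0..pi} (\<lambda>t. (resolvent_wave d k t)\<^sup>2)
        = integral {0..pi} (\<lambda>t. sin (real (Suc k) * t) * sin (real (Suc k) * t)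
          + 2 * sqrt d * (sin (real (Suc k) * t) * resolvent_wave d (Suc k) t)
          + d * (resolvent_wave d (Suc k) t)\<^sup>2)"
    proof (intro integral_cong)
      have dd: "sqrt d * (sqrt d * c) = d * c" for c using d by simp
      show "(resolvent_wave d k t)\<^sup>2 = sin (real (Suc k) * t) * sin (real (Suc k) * t)
          + 2 * sqrt d * (sin (real (Suc k) * t) * resolvent_wave d (Suc k) t)
          + d * (resolvent_wave d (Suc k) t)\<^sup>2" for t
        unfolding resolvent_wave_step[OF d, of k] power2_eq_square by (simp add: algebra_simps dd)
    qed
    also have "\<dots> = integral {0..pi} (\<lambda>t. sin (real (Suc k) * t) * sin (real (Suc k) * t))
        + integral {0..pi} (\<lambda>t. 2 * sqrt d * (sin (real (Suc k) * t) * resolvent_wave d (Suc k) t))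
        + integral {0..pi} (\<lambda>t. d * (resolvent_wave d (Suc k) t)\<^sup>2)"
      by (subst Henstock_Kurzweil_Integration.integral_add
          | intro integrable_continuous_interval continuous_intros refl)+
    also have "\<dots> = pi / 2 + d * integral {0..pi} (\<lambda>t. (resolvent_wave d (Suc k) t)\<^sup>2)"
      unfolding integral_sin_sin
      by (simp add: integral_sin_resolvent_wave_eq_0[OF d] mult.assoc del: of_nat_Suc)
    finally show ?thesis using d by (simp add: x_def field_simps)
  qed
  have "x k = 0"
  proof (rule bounded_backward_contraction_zero[where start = 0])
    show "\<bar>d\<bar> < 1" using d by simp
    show "x n = d * x (Suc n)" for n by (rule step)
    show "\<bar>x n\<bar> \<le> B\<^sup>2 * pi + \<bar>pi / 2 / (1 - d)\<bar>" for n by (rule bound)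
  qed simp
  then show ?thesis by (simp add: x_def)
qed

text \<open>Only the frequencies \<open>k\<close> and \<open>k + 1\<close> occur in the wave. The resolvent wave has no component at
  the former and component \<open>1\<close> at the latter.\<close>
lemma integral_wave_resolvent_wave:
  assumes d: "0 < d" "d < 1"
  shows "integral {0..pi} (\<lambda>t. wave d k t * resolvent_wave d k t) = pi / 2"
proof -
  note [continuous_intros] = continuous_resolvent_wave[OF d]
  have "integral {0..pi} (\<lambda>t. wave d k t * resolvent_wave d k t)
      = integral {0..pi} (\<lambda>t. sin (real (Suc k) * t) * sin (real (Suc k) * t)
        + sqrt d * (sin (real (Suc k) * t) * resolvent_wave d (Suc k) t)
        - sqrt d * (sin (real k * t) * resolvent_wave d k t))"
  proof (intro integral_cong)
    fix t
    have "wave d k t * resolvent_wave d k t = sin (real (Suc k) * t) * resolvent_wave d k t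
        - sqrt d * (sin (real k * t) * resolvent_wave d k t)"
      by (simp add: wave_def algebra_simps)
    also have "sin (real (Suc k) * t) * resolvent_wave d k t
        = sin (real (Suc k) * t) * sin (real (Suc k) * t)
        + sqrt d * (sin (real (Suc k) * t) * resolvent_wave d (Suc k) t)"
      unfolding resolvent_wave_step[OF d, of k] by (simp only: algebra_simps)
    finally show "wave d k t * resolvent_wave d k t
        = sin (real (Suc k) * t) * sin (real (Suc k) * t)
        + sqrt d * (sin (real (Suc k) * t) * resolvent_wave d (Suc k) t)
        - sqrt d * (sin (real k * t) * resolvent_wave d k t)" .
  qed
  also have "\<dots> = integral {0..pi} (\<lambda>t. sin (real (Suc k) * t) * sin (real (Suc k) * t))
      + integral {0..pi} (\<lambda>t. sqrt d * (sin (real (Suc k) * t) * resolvent_wave d (Suc k) t))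
      - integral {0..pi} (\<lambda>t. sqrt d * (sin (real k * t) * resolvent_wave d k t))"
    by (subst Henstock_Kurzweil_Integration.integral_diff Henstock_Kurzweil_Integration.integral_add
        | intro integrable_continuous_interval continuous_intros refl)+
  also have "\<dots> = pi / 2"
    unfolding integral_sin_sin
    by (simp add: integral_sin_resolvent_wave_eq_0[OF d] del: of_nat_Suc)
  finally show ?thesis .
qed

lemma integral_wave_sq:
  assumes "0 < d"
  shows "integral {0..pi} (\<lambda>t. (wave d k t)\<^sup>2) = (if k = 0 then pi / 2 else pi / 2 * (1 + d))"
proof -
  have dd: "sqrt d * (sqrt d * c) = d * c" for c using assms by simp
  have "integral {0..pi} (\<lambda>t. (wave d k t)\<^sup>2)
      = integral {0..pi} (\<lambda>t. sin (real (Suc k) * t) * sin (real (Suc k) * t)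
        - 2 * sqrt d * (sin (real (Suc k) * t) * sin (real k * t))
        + d * (sin (real k * t) * sin (real k * t)))"
    by (intro integral_cong) (simp add: wave_def power2_eq_square algebra_simps dd)
  also have "\<dots> = integral {0..pi} (\<lambda>t. sin (real (Suc k) * t) * sin (real (Suc k) * t))
      - integral {0..pi} (\<lambda>t. 2 * sqrt d * (sin (real (Suc k) * t) * sin (real k * t)))
      + integral {0..pi} (\<lambda>t. d * (sin (real k * t) * sin (real k * t)))"
    by (subst Henstock_Kurzweil_Integration.integral_diff Henstock_Kurzweil_Integration.integral_add
        | intro integrable_continuous_interval continuous_intros refl)+
  also have "\<dots> = pi / 2 + d * integral {0..pi} (\<lambda>t. sin (real k * t) * sin (real k * t))"
    using integral_sin_sin[of k k] integral_sin_sin[of k "Suc k"]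
    by (simp add: mult.assoc del: of_nat_Suc)
  also have "integral {0..pi} (\<lambda>t. sin (real k * t) * sin (real k * t)) = (if k = 0 then 0 else pi / 2)"
    using integral_sin_sin[of "k - 1" k] by (cases k) (simp_all del: of_nat_Suc)
  finally show ?thesis by (simp add: algebra_simps)
qed

text \<open>At \<open>d = 1\<close> the wave is a difference of consecutive sines and factors as
  \<open>2 sin (t / 2) cos ((2 k + 1) t / 2)\<close>, while \<open>\<lambda>\<close> is \<open>4 sin\<^sup>2 (t / 2)\<close>.\<close>
lemma wave_sq_critical:
  "(wave 1 k t)\<^sup>2 = mp_angle 1 t * (1 / 2 * (1 + cos (real_of_int (2 * int k + 1) * t)))"
proof -
  have a: "wave 1 k t = 2 * sin (t / 2) * cos ((2 * real k + 1) * (t / 2))"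
    using sin_diff_sin[of "real (Suc k) * t" "real k * t"] by (simp add: wave_def field_simps)
  have b: "mp_angle 1 t = 4 * (sin (t / 2))\<^sup>2"
    using cos_double_sin[of "t / 2"] by (simp add: mp_angle_def)
  have c: "1 + cos (real_of_int (2 * int k + 1) * t) = 2 * (cos ((2 * real k + 1) * (t / 2)))\<^sup>2"
    using cos_double_cos[of "(2 * real k + 1) * (t / 2)"] by (simp add: algebra_simps)
  show ?thesis unfolding a b c by (simp add: power_mult_distrib)
qed

lemma err_sq_2_critical:
  "integrable (mp_law 1) (err_integrand 2 k 1)" "err_sq 2 k 1 = 1"
proof -
  define G where "G = (\<lambda>t. 1 / 2 * (1 + cos (real_of_int (2 * int k + 1) * t)))"
  have cont: "continuous_on {0..pi} G" unfolding G_def by (intro continuous_intros)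
  have eq: "mp_angle 1 t powi (2 - 3) * (wave 1 k t)\<^sup>2 = G t" if "0 < t" "t < pi" for t
    using mp_angle_pos[OF _ that, of 1] wave_sq_critical[of k t]
    by (simp add: G_def power_int_minus field_simps)
  have formula: "integrable (mp_law 1) (err_integrand 2 k 1)"
    "err_sq 2 k 1 = 2 / pi * 1 ^ k * integral {0..pi} G"
    using err_sq_eq_wave_integral[of 1 G 2 k] cont eq by auto
  show "integrable (mp_law 1) (err_integrand 2 k 1)" by (rule formula(1))
  have "integral {0..pi} G = 1 / 2 * integral {0..pi} (\<lambda>t. 1 + cos (real_of_int (2 * int k + 1) * t))"
    unfolding G_def by (rule integral_mult_right)
  also have "integral {0..pi} (\<lambda>t. 1 + cos (real_of_int (2 * int k + 1) * t))
      = integral {0..pi} (\<lambda>t. 1) + integral {0..pi} (\<lambda>t. cos (real_of_int (2 * int k + 1) * t))"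
    by (intro Henstock_Kurzweil_Integration.integral_add integrable_continuous_interval continuous_intros)
  also have "\<dots> = pi" unfolding integral_cos_multiple by (auto; presburger)
  finally show "err_sq 2 k 1 = 1" using formula(2) by simp
qed

section \<open>Values and decay of the errors\<close>

text \<open>The integrand in the angle is continuous on the closed interval either because \<open>\<lambda>\<close> has no zero
  or because the exponent is nonnegative. The pair \<open>d = 1\<close>, \<open>l = 2\<close> escapes both reasons and is
  the content of \<open>err_sq_2_critical\<close>.\<close>
lemma err_sq_wave_regular:
  assumes "0 < d" "d < 1 \<or> l \<ge> 3"
  shows "integrable (mp_law d) (err_integrand l k d)"
    and "err_sq l k d = 2 / pi * d ^ k * integral {0..pi} (\<lambda>t. mp_angle d t powi (l - 3) * (wave d k t)\<^sup>2)"
proof -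
  have cont: "continuous_on {0..pi} (\<lambda>t. mp_angle d t powi (l - 3) * (wave d k t)\<^sup>2)"
  proof (cases "d < 1")
    case True
    then have "mp_angle d t \<noteq> 0" for t
      using mp_angle_pos_less_one[OF assms(1), of t] by simp
    then show ?thesis by (intro continuous_intros) auto
  next
    case False
    with assms have "l - 3 \<ge> 0" by simp
    then show ?thesis unfolding power_int_def by (auto intro!: continuous_intros)
  qed
  show "integrable (mp_law d) (err_integrand l k d)"
    and "err_sq l k d = 2 / pi * d ^ k * integral {0..pi} (\<lambda>t. mp_angle d t powi (l - 3) * (wave d k t)\<^sup>2)"
    using err_sq_eq_wave_integral[OF assms(1) cont refl] by auto
qed

lemma err_sq_tendsto_0:
  assumes d: "0 < d" "d < 1"
  shows "(\<lambda>k. err_sq l k d) \<longlonglongrightarrow> 0"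
proof -
  have nz: "mp_angle d t \<noteq> 0" for t using mp_angle_pos_less_one[OF d, of t] by simp
  have cont: "continuous_on {0..pi} (\<lambda>t. mp_angle d t powi (l - 3))"
    using nz by (intro continuous_intros) auto
  have "compact ((\<lambda>t. mp_angle d t powi (l - 3)) ` {0..pi})"
    using cont by (intro compact_continuous_image) auto
  then obtain C where C: "\<And>t. t \<in> {0..pi} \<Longrightarrow> \<bar>mp_angle d t powi (l - 3)\<bar> \<le> C"
    using compact_imp_bounded[THEN bounded_iff[THEN iffD1]] by (metis imageI real_norm_def)
  have "\<bar>err_sq l k d\<bar> \<le> 2 / pi * (C * (1 + sqrt d)\<^sup>2 * pi) * d ^ k" for k
  proof -
    have "norm (mp_angle d t powi (l - 3) * (wave d k t)\<^sup>2) \<le> C * (1 + sqrt d)\<^sup>2" if "t \<in> {0..pi}" for t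
    proof -
      have "\<bar>wave d k t\<bar>\<^sup>2 \<le> (1 + sqrt d)\<^sup>2" using abs_wave_le[OF d(1)] by (intro power_mono) auto
      moreover have "0 \<le> C" using C[OF that] by linarith
      ultimately show ?thesis using C[OF that] by (simp only: real_norm_def abs_mult power_abs) (intro mult_mono; simp)
    qed
    then have "norm (integral {0..pi} (\<lambda>t. mp_angle d t powi (l - 3) * (wave d k t)\<^sup>2))
        \<le> C * (1 + sqrt d)\<^sup>2 * (pi - 0)"
      by (intro integral_bound continuous_intros cont) auto
    then have "2 / pi * d ^ k * \<bar>integral {0..pi} (\<lambda>t. mp_angle d t powi (l - 3) * (wave d k t)\<^sup>2)\<bar>
        \<le> 2 / pi * d ^ k * (C * (1 + sqrt d)\<^sup>2 * pi)"
      using d by (intro mult_left_mono) auto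
    moreover have "\<bar>err_sq l k d\<bar>
        = 2 / pi * d ^ k * \<bar>integral {0..pi} (\<lambda>t. mp_angle d t powi (l - 3) * (wave d k t)\<^sup>2)\<bar>"
      using err_sq_wave_regular(2)[of d l k] d by (simp add: abs_mult)
    ultimately show ?thesis by (simp add: mult_ac)
  qed
  moreover have "(\<lambda>k. 2 / pi * (C * (1 + sqrt d)\<^sup>2 * pi) * d ^ k) \<longlonglongrightarrow> 0"
    using d by (intro tendsto_mult_right_zero LIMSEQ_power_zero) simp
  ultimately show ?thesis
    by (intro Lim_null_comparison[of "\<lambda>k. err_sq l k d"]) auto
qed

lemma err_sq_1:
  assumes d: "0 < d" "d < 1"
  shows "err_sq 1 k d = d ^ k / (1 - d)"
proof -
  have "mp_angle d t powi (1 - 3) * (wave d k t)\<^sup>2 = (resolvent_wave d k t)\<^sup>2" for t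
    by (simp add: resolvent_wave_def power_int_def field_simps)
  then have "err_sq 1 k d = 2 / pi * d ^ k * (pi / 2 / (1 - d))"
    using err_sq_wave_regular(2)[of d 1 k] d
    by (simp only: integral_resolvent_wave_sq[OF d, of k]) simp
  also have "\<dots> = d ^ k / (1 - d)"
    using d by (simp add: field_simps)
  finally show ?thesis .
qed

lemma err_sq_2:
  assumes d: "0 < d" "d \<le> 1"
  shows "err_sq 2 k d = d ^ k"
proof (cases "d = 1")
  case True
  then show ?thesis by (simp add: err_sq_2_critical)
next
  case False
  have "mp_angle d t powi (2 - 3) * (wave d k t)\<^sup>2 = wave d k t * resolvent_wave d k t" for t
    by (simp add: resolvent_wave_def power_int_def field_simps power2_eq_square)
  then show ?thesis
    using err_sq_wave_regular(2)[of d 2 k] integral_wave_resolvent_wave[of d k] d False by simp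
qed

lemma err_sq_3:
  assumes "0 < d"
  shows "err_sq 3 k d = (if k = 0 then 1 else d ^ k * (1 + d))"
  using err_sq_wave_regular(2)[of d 3 k] integral_wave_sq[OF assms, of k] assms by simp

theorem theorem3p2:
  fixes d :: real
  assumes "0 < d" and "d \<le> 1"
  shows "(\<forall>(l::int) (k::nat). d < 1 \<or> l \<ge> 2 \<longrightarrow> integrable (mp_law d) (err_integrand l k d)) \<and>
         (d < 1 \<longrightarrow> (\<forall>l::int. (\<lambda>k. err_sq l k d) \<longlonglongrightarrow> 0)) \<and>
         (d < 1 \<longrightarrow> (\<forall>k::nat. err_sq 1 k d = d ^ k / (1 - d))) \<and>
         (\<forall>k::nat. err_sq 2 k d = d ^ k) \<and>
         (\<forall>k::nat. k \<ge> 1 \<longrightarrow> err_sq 3 k d = d ^ k * (1 + d)) \<and>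
         err_sq 3 0 d = 1"
proof (intro conjI allI impI)
  fix l :: int and k :: nat
  assume l: "d < 1 \<or> l \<ge> 2"
  show "integrable (mp_law d) (err_integrand l k d)"
  proof (cases "d < 1 \<or> l \<ge> 3")
    case True
    then show ?thesis using assms by (intro err_sq_wave_regular)
  next
    case False
    then have "d = 1" "l = 2" using assms l by auto
    then show ?thesis by (simp add: err_sq_2_critical)
  qed
qed (use assms in \<open>simp_all add: err_sq_tendsto_0 err_sq_1 err_sq_2 err_sq_3\<close>)

end
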